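(* If a hypersequent $G$ in which all scalars (all weights and all scalars occurring inside terms) are rational numbers has a CAN-free derivation in $\mathbf{HR}$, then $G$ also has a derivation in $\mathbf{HR}$ that is both CAN-free and T-free.
   Context: Terms. Fix a countable set of variables $x,y,z,\dots$. Terms (in negation normal form) are generated by $A ::= x \mid \overline{x} \mid 0 \mid A+A \mid rA \mid A\sqcup A \mid A\sqcap A$, where $x$ is a variable, $\overline{x}$ is the corresponding negated variable, and $r\in\mathbb{R}_{>0}$. The negation $\overline{A}$ of a term is defined by $\overline{x}$ (for $x$), $\overline{\overline{x}}=x$, $\overline{0}=0$, $\overline{A+B}=\overline{A}+\overline{B}$, $\overline{rA}=r\overline{A}$, $\overline{A\sqcup B}=\overline{A}\sqcap\overline{B}$, $\overline{A\sqcap B}=\overline{A}\sqcup\overline{B}$. A weighted term is $r.A$ with $r\in\mathbb{R}_{>0}$; a sequent $\vdash\Gamma$ has $\Gamma$ a finite (possibly empty) multiset of weighted terms; a hypersequent is a nonempty finite multiset of sequents, written $\vdash\Gamma_1\mid\cdots\mid\vdash\Gamma_n$, and $G\mid\vdash\Gamma$ denotes the hypersequent $G$ with the sequent $\vdash\Gamma$ added. For a finite (possibly empty) sequence $\vec r=(r_1,\dots,r_n)$ of strictly positive reals, $\vec r.A$ is the multiset $r_1.A,\dots,r_n.A$, $\sum\vec r=r_1+\dots+r_n$, and $s\vec r=(sr_1,\dots,sr_n)$; for $s>0$, $s.\Gamma$ multiplies every weight in $\Gamma$ by $s$. The calculus $\mathbf{HR}$ has the rules (vectors are finite sequences of strictly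 positive reals): INIT: the hypersequent $\vdash$ (one empty sequent) with no premises. W: from $G$ infer $G\mid\vdash\Gamma$. C: from $G\mid\vdash\Gamma\mid\vdash\Gamma$ infer $G\mid\vdash\Gamma$. S: from $G\mid\vdash\Gamma_1,\Gamma_2$ infer $G\mid\vdash\Gamma_1\mid\vdash\Gamma_2$. M: from $G\mid\vdash\Gamma_1$ and $G\mid\vdash\Gamma_2$ infer $G\mid\vdash\Gamma_1,\Gamma_2$. T: for $r>0$, from $G\mid\vdash r.\Gamma$ infer $G\mid\vdash\Gamma$. ID: if $\sum\vec r=\sum\vec s$, from $G\mid\vdash\Gamma$ infer $G\mid\vdash\Gamma,\vec r.x,\vec s.\overline{x}$ ($x$ a variable). 0: from $G\mid\vdash\Gamma$ infer $G\mid\vdash\Gamma,\vec r.0$. $+$: from $G\mid\vdash\Gamma,\vec r.A,\vec r.B$ infer $G\mid\vdash\Gamma,\vec r.(A+B)$. $\times$: from $G\mid\vdash\Gamma,(s\vec r).A$ infer $G\mid\vdash\Gamma,\vec r.(sA)$. $\sqcup$: from $G\mid\vdash\Gamma,\vec r.A\mid\vdash\Gamma,\vec r.B$ infer $G\mid\vdash\Gamma,\vec r.(A\sqcup B)$. $\sqcap$: from $G\mid\vdash\Gamma,\vec r.A$ and $G\mid\vdash\Gamma,\vec r.B$ infer $G\mid\vdash\Gamma,\vec r.(A\sqcap B)$. CAN: if $\sum\vec r=\sum\vec s$, from $G\mid\vdash\Gamma,\vec s.A,\vec r.\overline{A}$ infer $G\mid\vdash\Gamma$. A derivation is a finite tree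 of rule instances whose leaves are INIT; it is CAN-free (resp. T-free) if it contains no instance of CAN (resp. T). *)

theory Defs
  imports Complex_Main "HOL-Library.Multiset" "HOL-Library.Countable"
begin

text \<open>
  Terms in negation normal form. The type does not enforce positivity of scalars;
  this is the predicate \<open>wf_term\<close> below.
\<close>

datatype 'v rterm =
    Var 'v
  | NVar 'v
  | Zero
  | Add "'v rterm" "'v rterm"
  | Scale real "'v rterm"
  | Join "'v rterm" "'v rterm"
  | Meet "'v rterm" "'v rterm"

primrec neg :: "'v rterm \<Rightarrow> 'v rterm" where
  "neg (Var x) = NVar x"
| "neg (NVar x) = Var x"
| "neg Zero = Zero"
| "neg (Add A B) = Add (neg A) (neg B)"
| "neg (Scale r A) = Scale r (neg A)"
| "neg (Join A B) = Meet (neg A) (neg B)"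
| "neg (Meet A B) = Join (neg A) (neg B)"

primrec scalars :: "'v rterm \<Rightarrow> real set" where
  "scalars (Var x) = {}"
| "scalars (NVar x) = {}"
| "scalars Zero = {}"
| "scalars (Add A B) = scalars A \<union> scalars B"
| "scalars (Scale r A) = insert r (scalars A)"
| "scalars (Join A B) = scalars A \<union> scalars B"
| "scalars (Meet A B) = scalars A \<union> scalars B"

definition wf_term :: "'v rterm \<Rightarrow> bool" where
  "wf_term A \<longleftrightarrow> (\<forall>r \<in> scalars A. 0 < r)"

type_synonym 'v sequent = "(real \<times> 'v rterm) multiset"
type_synonym 'v hypersequent = "'v sequent multiset"

definition wf_sequent :: "'v sequent \<Rightarrow> bool" where
  "wf_sequent \<Gamma> \<longleftrightarrow> (\<forall>(r, A) \<in># \<Gamma>. 0 < r \<and> wf_term A)"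

definition wf_hypersequent :: "'v hypersequent \<Rightarrow> bool" where
  "wf_hypersequent G \<longleftrightarrow> G \<noteq> {#} \<and> (\<forall>\<Gamma> \<in># G. wf_sequent \<Gamma>)"

definition rational_hypersequent :: "'v hypersequent \<Rightarrow> bool" where
  "rational_hypersequent G \<longleftrightarrow>
     (\<forall>\<Gamma> \<in># G. \<forall>(r, A) \<in># \<Gamma>. r \<in> \<rat> \<and> scalars A \<subseteq> \<rat>)"

definition pos :: "real list \<Rightarrow> bool" where
  "pos rs \<longleftrightarrow> (\<forall>r \<in> set rs. 0 < r)"

definition weigh :: "real list \<Rightarrow> 'v rterm \<Rightarrow> 'v sequent" (infix "\<odot>" 75) where
  "rs \<odot> A = mset (map (\<lambda>r. (r, A)) rs)"

definition scale_sequent :: "real \<Rightarrow> 'v sequent \<Rightarrow> 'v sequent" where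
  "scale_sequent s \<Gamma> = image_mset (\<lambda>(r, A). (s * r, A)) \<Gamma>"

datatype rule =
    R_INIT | R_W | R_C | R_S | R_M | R_T | R_ID | R_0
  | R_plus | R_times | R_join | R_meet | R_CAN

text \<open>
  \<open>HR R G\<close> means that \<open>G\<close> has a (finite) derivation all of whose rule instances are
  instances of rules in \<open>R\<close>; thus \<open>HR UNIV\<close> is derivability in the full calculus, and
  \<open>HR (- {R_CAN})\<close> is derivability by a CAN-free derivation. The side context \<open>G\<close> of
  a rule may be the empty multiset, so that rules also apply to a single sequent. Side
  conditions on signs are imposed wherever positivity of the conclusion is not inherited
  from the premises (see \<open>HR_wf\<close>).
\<close>

inductive HR :: "rule set \<Rightarrow> 'v hypersequent \<Rightarrow> bool" for R :: "rule set" where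
  INIT: "R_INIT \<in> R \<Longrightarrow> HR R {#{#}#}"
| W: "R_W \<in> R \<Longrightarrow> wf_sequent \<Gamma> \<Longrightarrow> HR R G \<Longrightarrow> HR R (G + {#\<Gamma>#})"
| C: "R_C \<in> R \<Longrightarrow> HR R (G + {#\<Gamma>, \<Gamma>#}) \<Longrightarrow> HR R (G + {#\<Gamma>#})"
| S: "R_S \<in> R \<Longrightarrow> HR R (G + {#\<Gamma>\<^sub>1 + \<Gamma>\<^sub>2#}) \<Longrightarrow> HR R (G + {#\<Gamma>\<^sub>1, \<Gamma>\<^sub>2#})"
| M: "R_M \<in> R \<Longrightarrow> HR R (G + {#\<Gamma>\<^sub>1#}) \<Longrightarrow> HR R (G + {#\<Gamma>\<^sub>2#})
      \<Longrightarrow> HR R (G + {#\<Gamma>\<^sub>1 + \<Gamma>\<^sub>2#})"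
| T: "R_T \<in> R \<Longrightarrow> 0 < r \<Longrightarrow> HR R (G + {#scale_sequent r \<Gamma>#}) \<Longrightarrow> HR R (G + {#\<Gamma>#})"
| ID: "R_ID \<in> R \<Longrightarrow> pos rs \<Longrightarrow> pos ss \<Longrightarrow> sum_list rs = sum_list ss
      \<Longrightarrow> HR R (G + {#\<Gamma>#}) \<Longrightarrow> HR R (G + {#\<Gamma> + rs \<odot> Var x + ss \<odot> NVar x#})"
| zero: "R_0 \<in> R \<Longrightarrow> pos rs \<Longrightarrow> HR R (G + {#\<Gamma>#}) \<Longrightarrow> HR R (G + {#\<Gamma> + rs \<odot> Zero#})"
| plus: "R_plus \<in> R \<Longrightarrow> pos rs \<Longrightarrow> HR R (G + {#\<Gamma> + rs \<odot> A + rs \<odot> B#})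
      \<Longrightarrow> HR R (G + {#\<Gamma> + rs \<odot> Add A B#})"
| times: "R_times \<in> R \<Longrightarrow> pos rs \<Longrightarrow> 0 < s \<Longrightarrow> HR R (G + {#\<Gamma> + map ((*) s) rs \<odot> A#})
      \<Longrightarrow> HR R (G + {#\<Gamma> + rs \<odot> Scale s A#})"
| join: "R_join \<in> R \<Longrightarrow> pos rs \<Longrightarrow> HR R (G + {#\<Gamma> + rs \<odot> A, \<Gamma> + rs \<odot> B#})
      \<Longrightarrow> HR R (G + {#\<Gamma> + rs \<odot> Join A B#})"
| meet: "R_meet \<in> R \<Longrightarrow> pos rs \<Longrightarrow> HR R (G + {#\<Gamma> + rs \<odot> A#}) \<Longrightarrow> HR R (G + {#\<Gamma> + rs \<odot> B#})
      \<Longrightarrow> HR R (G + {#\<Gamma> + rs \<odot> Meet A B#})"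
| CAN: "R_CAN \<in> R \<Longrightarrow> pos rs \<Longrightarrow> pos ss \<Longrightarrow> sum_list rs = sum_list ss
      \<Longrightarrow> HR R (G + {#\<Gamma> + ss \<odot> A + rs \<odot> neg A#}) \<Longrightarrow> HR R (G + {#\<Gamma>#})"

lemma wf_sequent_empty [simp]: "wf_sequent {#}"
  by (simp add: wf_sequent_def)

lemma wf_sequent_plus [simp]:
  "wf_sequent (\<Gamma> + \<Delta>) \<longleftrightarrow> wf_sequent \<Gamma> \<and> wf_sequent \<Delta>"
  by (auto simp: wf_sequent_def)

lemma wf_sequent_weigh [simp]:
  "wf_sequent (rs \<odot> A) \<longleftrightarrow> rs = [] \<or> (pos rs \<and> wf_term A)"
  by (cases rs) (auto simp: wf_sequent_def weigh_def pos_def)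

lemma wf_sequent_scale [simp]:
  "0 < r \<Longrightarrow> wf_sequent (scale_sequent r \<Gamma>) \<longleftrightarrow> wf_sequent \<Gamma>"
  by (auto simp: wf_sequent_def scale_sequent_def zero_less_mult_iff split: prod.splits)

lemma wf_term_simps [simp]:
  "wf_term (Var x)" "wf_term (NVar x)" "wf_term Zero"
  "wf_term (Add A B) \<longleftrightarrow> wf_term A \<and> wf_term B"
  "wf_term (Scale r A) \<longleftrightarrow> 0 < r \<and> wf_term A"
  "wf_term (Join A B) \<longleftrightarrow> wf_term A \<and> wf_term B"
  "wf_term (Meet A B) \<longleftrightarrow> wf_term A \<and> wf_term B"
  by (auto simp: wf_term_def)

lemma HR_wf: "HR R G \<Longrightarrow> wf_hypersequent G"
  by (induction rule: HR.induct) (auto simp: wf_hypersequent_def)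

end

theory Submission imports Defs begin

text \<open>
  Every rule is sound for the Riesz space \<open>\<real>\<close>: if \<open>G\<close> is derivable, then under each real
  valuation some sequent of \<open>G\<close> has a nonnegative value. It therefore suffices to show that a
  rational hypersequent with this property has a derivation without \<open>T\<close> and \<open>CAN\<close>. Read
  backwards, the logical rules preserve the property, which reduces the claim to sequents of
  weighted literals, that is, to linear forms with rational coefficients. Fourier--Motzkin
  elimination over the rationals then yields a nonempty family of these sequents, with natural
  multiplicities, whose sum vanishes identically. This sum is derivable by \<open>ID\<close>, and \<open>S\<close>, \<open>C\<close>, \<open>W\<close>
  recover the hypersequent; the multiplicities being integers is what makes \<open>T\<close> superfluous.
\<close>

subsection \<open>Semantics in the reals\<close>

primrec term_val :: "('v \<Rightarrow> real) \<Rightarrow> 'v rterm \<Rightarrow> real" where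
  "term_val v (Var x) = v x"
| "term_val v (NVar x) = - v x"
| "term_val v Zero = 0"
| "term_val v (Add A B) = term_val v A + term_val v B"
| "term_val v (Scale r A) = r * term_val v A"
| "term_val v (Join A B) = max (term_val v A) (term_val v B)"
| "term_val v (Meet A B) = min (term_val v A) (term_val v B)"

definition seq_val :: "('v \<Rightarrow> real) \<Rightarrow> 'v sequent \<Rightarrow> real" where
  "seq_val v \<Gamma> = (\<Sum>(r, A)\<in>#\<Gamma>. r * term_val v A)"

text \<open>A hypersequent is read as the join of its sequents; in the reals a finite join is
  nonnegative exactly when one of its members is.\<close>

definition valid :: "'v hypersequent \<Rightarrow> bool" where
  "valid G \<longleftrightarrow> (\<forall>v. \<exists>\<Gamma>\<in>#G. 0 \<le> seq_val v \<Gamma>)"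

lemma term_val_neg [simp]: "term_val v (neg A) = - term_val v A"
  by (induction A) auto

lemma seq_val_empty [simp]: "seq_val v {#} = 0"
  by (simp add: seq_val_def)

lemma seq_val_add_mset [simp]: "seq_val v (add_mset (r, A) \<Gamma>) = r * term_val v A + seq_val v \<Gamma>"
  by (simp add: seq_val_def)

lemma seq_val_plus [simp]: "seq_val v (\<Gamma> + \<Delta>) = seq_val v \<Gamma> + seq_val v \<Delta>"
  by (simp add: seq_val_def)

lemma seq_val_repeat [simp]: "seq_val v (repeat_mset n \<Gamma>) = of_nat n * seq_val v \<Gamma>"
  by (induction n) (simp_all add: algebra_simps)

lemma seq_val_weigh [simp]: "seq_val v (rs \<odot> A) = sum_list rs * term_val v A"
  by (induction rs) (simp_all add: weigh_def algebra_simps)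

lemma seq_val_scale [simp]: "seq_val v (scale_sequent s \<Gamma>) = s * seq_val v \<Gamma>"
  by (induction \<Gamma>) (auto simp: scale_sequent_def algebra_simps)

lemma pos_sum_list_nonneg: "pos rs \<Longrightarrow> 0 \<le> sum_list rs"
  by (force simp: pos_def intro: sum_list_nonneg)

lemma valid_add_mset:
  "valid (add_mset \<Gamma> G) \<longleftrightarrow> (\<forall>v. (\<exists>\<Delta>\<in>#G. 0 \<le> seq_val v \<Delta>) \<or> 0 \<le> seq_val v \<Gamma>)"
  by (auto simp: valid_def)

lemma valid_plus_single:
  "valid (G + {#\<Gamma>#}) \<longleftrightarrow> (\<forall>v. (\<exists>\<Delta>\<in>#G. 0 \<le> seq_val v \<Delta>) \<or> 0 \<le> seq_val v \<Gamma>)"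
  by (simp add: valid_add_mset)

lemma sum_list_map_mult_left: "sum_list (map ((*) s) rs) = s * sum_list (rs :: real list)"
  by (induction rs) (simp_all add: algebra_simps)

text \<open>The given derivation is used only through this lemma. The valuation is fixed rule by
  rule: for \<open>S\<close>, a nonnegative sum has a nonnegative summand; for \<open>T\<close>, a
  positive factor keeps the sign; for \<open>ID\<close> and \<open>CAN\<close>, the entries
  concerned contribute 0 in total.\<close>

lemma HR_imp_valid: "HR R G \<Longrightarrow> valid G"
proof (induction rule: HR.induct)
  case INIT
  then show ?case by (simp add: valid_def)
next
  case (W \<Gamma> G)
  then show ?case by (auto simp: valid_def)
next
  case (C G \<Gamma>)
  then show ?case by (auto simp: valid_def)
next
  case (S G \<Gamma>\<^sub>1 \<Gamma>\<^sub>2)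
  show ?case unfolding valid_def
  proof
    fix v
    show "\<exists>\<Gamma>\<in>#G + {#\<Gamma>\<^sub>1, \<Gamma>\<^sub>2#}. 0 \<le> seq_val v \<Gamma>"
      using S.IH[unfolded valid_plus_single, rule_format, of v] by auto
  qed
next
  case (M G \<Gamma>\<^sub>1 \<Gamma>\<^sub>2)
  then show ?case unfolding valid_plus_single seq_val_plus by (meson add_nonneg_nonneg)
next
  case (T r G \<Gamma>)
  then show ?case by (simp add: valid_add_mset zero_le_mult_iff)
next
  case (ID rs ss G \<Gamma> x)
  then show ?case by (simp add: valid_add_mset)
next
  case (zero rs G \<Gamma>)
  then show ?case by (simp add: valid_add_mset)
next
  case (plus rs G \<Gamma> A B)
  then show ?case by (simp add: valid_add_mset algebra_simps)
next
  case (times rs s G \<Gamma> A)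
  then show ?case by (simp add: valid_add_mset sum_list_map_mult_left algebra_simps)
next
  case (join rs G \<Gamma> A B)
  show ?case unfolding valid_plus_single
  proof
    fix v
    \<comment> \<open>The vector may be empty, so its sum is only known to be nonnegative; that is
      enough for the conclusion to dominate both components of the premise.\<close>
    have "sum_list rs * term_val v A \<le> sum_list rs * max (term_val v A) (term_val v B)"
      "sum_list rs * term_val v B \<le> sum_list rs * max (term_val v A) (term_val v B)"
      using pos_sum_list_nonneg[OF join.hyps(2)] by (auto intro: mult_left_mono)
    then show "(\<exists>\<Delta>\<in>#G. 0 \<le> seq_val v \<Delta>) \<or> 0 \<le> seq_val v (\<Gamma> + rs \<odot> Join A B)"
      using join.IH[unfolded valid_def, rule_format, of v] by auto
  qed
next
  case (meet rs G \<Gamma> A B)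
  then show ?case by (fastforce simp: valid_add_mset min_def)
next
  case (CAN rs ss G \<Gamma> A)
  then show ?case by (simp add: valid_add_mset)
qed

subsection \<open>Elimination of variables\<close>

text \<open>\<open>Zero\<close> is excluded so that every nonempty sequent of literals contains a
  variable on which \<open>ID\<close> can act.\<close>

primrec literal :: "'v rterm \<Rightarrow> bool" where
  "literal (Var x) = True"
| "literal (NVar x) = True"
| "literal Zero = False"
| "literal (Add A B) = False"
| "literal (Scale r A) = False"
| "literal (Join A B) = False"
| "literal (Meet A B) = False"

definition rational_literals :: "'v sequent \<Rightarrow> bool" where
  "rational_literals \<Gamma> \<longleftrightarrow> (\<forall>(r, A) \<in># \<Gamma>. r \<in> \<rat> \<and> literal A)"

text \<open>On literals \<open>seq_val\<close> is a linear form in the valuation, and this is its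
  coefficient at \<open>x\<close>. Other entries count as 0, so it has this meaning only for
  sequents of literals.\<close>

definition coefficient :: "'v sequent \<Rightarrow> 'v \<Rightarrow> real" where
  "coefficient \<Gamma> x = (\<Sum>(r, A)\<in>#\<Gamma>. if A = Var x then r else if A = NVar x then - r else 0)"

lemma rational_literals_empty [simp]: "rational_literals {#}"
  by (simp add: rational_literals_def)

lemma rational_literals_plus [simp]:
  "rational_literals (\<Gamma> + \<Delta>) \<longleftrightarrow> rational_literals \<Gamma> \<and> rational_literals \<Delta>"
  by (auto simp: rational_literals_def)

lemma rational_literals_add_mset [simp]:
  "rational_literals (add_mset (r, A) \<Gamma>) \<longleftrightarrow> r \<in> \<rat> \<and> literal A \<and> rational_literals \<Gamma>"
  by (auto simp: rational_literals_def)

lemma rational_literals_repeat: "rational_literals \<Gamma> \<Longrightarrow> rational_literals (repeat_mset n \<Gamma>)"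
  by (induction n) simp_all

lemma coefficient_empty [simp]: "coefficient {#} x = 0"
  by (simp add: coefficient_def)

lemma coefficient_plus [simp]: "coefficient (\<Gamma> + \<Delta>) x = coefficient \<Gamma> x + coefficient \<Delta> x"
  by (simp add: coefficient_def)

lemma coefficient_add_mset [simp]:
  "coefficient (add_mset (r, A) \<Gamma>) x =
    (if A = Var x then r else if A = NVar x then - r else 0) + coefficient \<Gamma> x"
  by (simp add: coefficient_def)

lemma coefficient_repeat [simp]: "coefficient (repeat_mset n \<Gamma>) x = of_nat n * coefficient \<Gamma> x"
  by (induction n) (simp_all add: algebra_simps)

lemma coefficient_weigh [simp]:
  "coefficient (rs \<odot> A) x =
    (if A = Var x then sum_list rs else if A = NVar x then - sum_list rs else 0)"
  by (induction rs) (auto simp: weigh_def)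

lemma coefficient_rational: "rational_literals \<Gamma> \<Longrightarrow> coefficient \<Gamma> x \<in> \<rat>"
  by (induction \<Gamma>) auto

text \<open>Isolates the variable to be eliminated: the value is affine in \<open>t\<close>, and the
  remaining part of the form is expressed by evaluating at \<open>x := 0\<close>.\<close>

lemma seq_val_upd:
  assumes "rational_literals \<Gamma>"
  shows "seq_val (v(x := t)) \<Gamma> = t * coefficient \<Gamma> x + seq_val (v(x := 0)) \<Gamma>"
  using assms
proof (induction \<Gamma>)
  case (add p \<Gamma>)
  obtain r A where "p = (r, A)" by force
  with add show ?case by (cases A) (auto simp: algebra_simps)
qed simp

lemma finite_coefficient_support: "finite {x. coefficient \<Gamma> x \<noteq> 0}"
proof (induction \<Gamma>)
  case (add p \<Gamma>)
  obtain r A where p: "p = (r, A)" by force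
  have "finite {x. A = Var x \<or> A = NVar x}" by (cases A) auto
  moreover have "{x. coefficient (add_mset p \<Gamma>) x \<noteq> 0}
      \<subseteq> {x. A = Var x \<or> A = NVar x} \<union> {x. coefficient \<Gamma> x \<noteq> 0}"
    by (auto simp: p)
  ultimately show ?case using add by (meson finite_UnI finite_subset)
qed simp

text \<open>Nonempty combinations with natural coefficients, the coefficients being the
  multiplicities in \<open>M\<close>. Nonemptiness matters: the empty sum always vanishes and
  carries no information.\<close>

definition sums_of :: "'v sequent set \<Rightarrow> 'v sequent set" where
  "sums_of F = {\<Sum>\<^sub># M | M. M \<noteq> {#} \<and> set_mset M \<subseteq> F}"

lemma subset_sums_of: "F \<subseteq> sums_of F"
  unfolding sums_of_def by (auto intro!: exI[of _ "{#_#}"])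

lemma sums_of_plus:
  assumes "\<Gamma> \<in> sums_of F" "\<Delta> \<in> sums_of F"
  shows "\<Gamma> + \<Delta> \<in> sums_of F"
proof -
  obtain M N where "\<Gamma> = \<Sum>\<^sub># M" "M \<noteq> {#}" "set_mset M \<subseteq> F"
    "\<Delta> = \<Sum>\<^sub># N" "N \<noteq> {#}" "set_mset N \<subseteq> F"
    using assms unfolding sums_of_def by blast
  then have "\<Gamma> + \<Delta> = \<Sum>\<^sub># (M + N)" "M + N \<noteq> {#}" "set_mset (M + N) \<subseteq> F" by auto
  then show ?thesis unfolding sums_of_def by blast
qed

lemma sums_of_repeat:
  assumes "\<Gamma> \<in> sums_of F" "0 < n"
  shows "repeat_mset n \<Gamma> \<in> sums_of F"
  using assms(2)
proof (induction n rule: nat_induct_non_zero)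
  case 1
  then show ?case using assms(1) by simp
next
  case (Suc n)
  then show ?case using assms(1) by (simp add: sums_of_plus)
qed

text \<open>Combinations of combinations are combinations, which lets the variables be eliminated
  one after the other.\<close>

lemma sums_of_idem:
  assumes "F' \<subseteq> sums_of F"
  shows "sums_of F' \<subseteq> sums_of F"
proof -
  have "\<Sum>\<^sub># M \<in> sums_of F" if "M \<noteq> {#}" "set_mset M \<subseteq> F'" for M
    using that
  proof (induction M)
    case (add \<Gamma> M)
    then show ?case using assms by (cases "M = {#}") (auto intro: sums_of_plus)
  qed simp
  then show ?thesis by (auto simp: sums_of_def)
qed

text \<open>This is where rationality enters: the positive rational \<open>- p / n\<close> is a
  quotient \<open>b / a\<close> of naturals. For an irrational ratio no positive natural
  multiplicities would cancel.\<close>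

lemma rational_cancellation:
  fixes p n :: real
  assumes "p \<in> \<rat>" "n \<in> \<rat>" "0 < p" "n < 0"
  obtains a b :: nat where "0 < a" "0 < b" "of_nat a * p + of_nat b * n = 0"
proof -
  have "- p / n \<in> \<rat>" "0 < - p / n"
    using assms by (auto simp: divide_less_0_iff)
  then obtain b a :: nat where *: "a \<noteq> 0" "\<bar>- p / n\<bar> = of_nat b / of_nat a"
    by (elim Rats_abs_nat_div_natE) auto
  then have "- p / n = of_nat b / of_nat a" using \<open>0 < - p / n\<close> by (simp only: abs_of_pos)
  moreover have "0 < b" using * \<open>0 < - p / n\<close> by (cases b) auto
  ultimately show ?thesis
    using that[of a b] *(1) assms by (simp add: field_simps)
qed

text \<open>Supplies a value for the eliminated variable between its strict lower bounds and its
  strict upper bounds.\<close>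

lemma finite_separation:
  fixes A B :: "real set"
  assumes "finite A" "finite B" "\<And>a b. a \<in> A \<Longrightarrow> b \<in> B \<Longrightarrow> a < b"
  shows "\<exists>t. (\<forall>a\<in>A. a < t) \<and> (\<forall>b\<in>B. t < b)"
proof (cases "A = {} \<or> B = {}")
  case True
  then show ?thesis
  proof
    assume "A = {}"
    then show ?thesis
      \<comment> \<open>If \<open>B\<close> is empty too, \<open>Min B\<close> is unspecified, but
        then both conditions are vacuous.\<close>
      using assms(2) by (intro exI[of _ "Min B - 1"]) (fastforce dest: Min_le)
  next
    assume "B = {}"
    then show ?thesis
      using assms(1) by (intro exI[of _ "Max A + 1"]) (fastforce dest: Max_ge)
  qed
next
  case False
  then have "Max A < Min B" using assms by simp
  then obtain t where "Max A < t" "t < Min B" using dense by blast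
  then show ?thesis using False assms(1,2) by auto
qed

text \<open>
  A rational form of Gordan's theorem; \<open>X\<close> contains the variables still to be eliminated.
\<close>
lemma valid_imp_vanishing_sum:
  assumes "finite X" "finite F"
    and "\<And>\<Gamma>. \<Gamma> \<in> F \<Longrightarrow> rational_literals \<Gamma>"
    and "\<And>\<Gamma> x. \<Gamma> \<in> F \<Longrightarrow> x \<notin> X \<Longrightarrow> coefficient \<Gamma> x = 0"
    and "\<And>v. \<exists>\<Gamma>\<in>F. 0 \<le> seq_val v \<Gamma>"
  shows "\<exists>\<Gamma>\<in>sums_of F. \<forall>x. coefficient \<Gamma> x = 0"
  using assms
proof (induction X arbitrary: F rule: finite_induct)
  case empty
  \<comment> \<open>Validity at any valuation makes \<open>F\<close> nonempty, and no variable is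
    left, so any member already vanishes.\<close>
  then obtain \<Gamma> where "\<Gamma> \<in> F" by blast
  with empty show ?case using subset_sums_of by blast
next
  case (insert x X F)
  note rat = insert.prems(2)
  \<comment> \<open>Making a member negative bounds the value of \<open>x\<close> from above for
    \<open>P\<close>, from below for \<open>N\<close>, and does not constrain it for
    \<open>Z\<close>.\<close>
  define P where "P = {\<Gamma> \<in> F. 0 < coefficient \<Gamma> x}"
  define N where "N = {\<Gamma> \<in> F. coefficient \<Gamma> x < 0}"
  define Z where "Z = {\<Gamma> \<in> F. coefficient \<Gamma> x = 0}"
  have fin: "finite P" "finite N" "finite Z"
    using insert.prems(1) by (auto simp: P_def N_def Z_def)
  have "\<exists>a b :: nat. 0 < a \<and> 0 < b \<and>
      of_nat a * coefficient \<Gamma> x + of_nat b * coefficient \<Delta> x = 0"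
    if "\<Gamma> \<in> P" "\<Delta> \<in> N" for \<Gamma> \<Delta>
  proof -
    have "coefficient \<Gamma> x \<in> \<rat>" "coefficient \<Delta> x \<in> \<rat>"
      "0 < coefficient \<Gamma> x" "coefficient \<Delta> x < 0"
      using that rat by (auto simp: P_def N_def intro: coefficient_rational)
    then show ?thesis by (metis rational_cancellation)
  qed
  then obtain a b :: "'a sequent \<Rightarrow> 'a sequent \<Rightarrow> nat" where
    ab: "\<And>\<Gamma> \<Delta>. \<Gamma> \<in> P \<Longrightarrow> \<Delta> \<in> N \<Longrightarrow> 0 < a \<Gamma> \<Delta> \<and> 0 < b \<Gamma> \<Delta> \<and>
      of_nat (a \<Gamma> \<Delta>) * coefficient \<Gamma> x + of_nat (b \<Gamma> \<Delta>) * coefficient \<Delta> x = 0"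
    by metis
  \<comment> \<open>The Fourier-Motzkin step: each pair of an upper and a lower bound is combined so
    that \<open>x\<close> cancels.\<close>
  define h where "h \<Gamma> \<Delta> = repeat_mset (a \<Gamma> \<Delta>) \<Gamma> + repeat_mset (b \<Gamma> \<Delta>) \<Delta>" for \<Gamma> \<Delta>
  define F' where "F' = Z \<union> (\<lambda>(\<Gamma>, \<Delta>). h \<Gamma> \<Delta>) ` (P \<times> N)"
  have F'_sub: "F' \<subseteq> sums_of F"
  proof -
    have "h \<Gamma> \<Delta> \<in> sums_of F" if "\<Gamma> \<in> P" "\<Delta> \<in> N" for \<Gamma> \<Delta>
    proof -
      have "\<Gamma> \<in> sums_of F" "\<Delta> \<in> sums_of F"
        using that subset_sums_of by (auto simp: P_def N_def)
      then show ?thesis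
        unfolding h_def using ab[OF that] by (intro sums_of_plus sums_of_repeat) auto
    qed
    then show ?thesis using subset_sums_of by (auto simp: F'_def Z_def)
  qed
  have "\<exists>\<Gamma>\<in>sums_of F'. \<forall>x. coefficient \<Gamma> x = 0"
  proof (rule insert.IH)
    show "finite F'" using fin by (simp add: F'_def)
    show "rational_literals \<Gamma>" if "\<Gamma> \<in> F'" for \<Gamma>
      using that rat by (auto simp: F'_def P_def N_def Z_def h_def intro!: rational_literals_repeat)
    show "coefficient \<Gamma> y = 0" if "\<Gamma> \<in> F'" "y \<notin> X" for \<Gamma> y
    proof (cases "y = x")
      case True
      then show ?thesis using that ab by (auto simp: F'_def Z_def h_def)
    next
      case False
      then show ?thesis using that insert.prems(3) by (auto simp: F'_def P_def N_def Z_def h_def)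
    qed
    show "\<exists>\<Gamma>\<in>F'. 0 \<le> seq_val v \<Gamma>" for v
    \<comment> \<open>A valuation that makes all of \<open>F'\<close> negative is changed at
      \<open>x\<close> alone so as to make all of \<open>F\<close> negative.\<close>
    proof (rule ccontr)
      assume "\<not> ?thesis"
      then have neg: "seq_val v \<Gamma> < 0" if "\<Gamma> \<in> F'" for \<Gamma> using that by force
      \<comment> \<open>The bound on \<open>x\<close>: the point where the value changes sign as
        \<open>x\<close> varies. It is used only where the coefficient is nonzero.\<close>
      define q where "q \<Gamma> = - seq_val (v(x := 0)) \<Gamma> / coefficient \<Gamma> x" for \<Gamma>
      have val: "seq_val (v(x := t)) \<Gamma> = (t - q \<Gamma>) * coefficient \<Gamma> x"
        if "\<Gamma> \<in> F" "coefficient \<Gamma> x \<noteq> 0" for t \<Gamma>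
        using that seq_val_upd[OF rat, of \<Gamma> v x t] by (simp add: q_def field_simps)
      \<comment> \<open>Negativity of \<open>h \<Gamma> \<Delta>\<close> at \<open>v\<close> says
        exactly that the lower bound lies below the upper one.\<close>
      have "q \<Delta> < q \<Gamma>" if "\<Gamma> \<in> P" "\<Delta> \<in> N" for \<Gamma> \<Delta>
      proof -
        note ab = ab[OF that]
        have "h \<Gamma> \<Delta> \<in> F'" using that by (auto simp: F'_def)
        then have "of_nat (a \<Gamma> \<Delta>) * seq_val v \<Gamma> + of_nat (b \<Gamma> \<Delta>) * seq_val v \<Delta> < 0"
          using neg by (force simp: h_def)
        moreover have "seq_val v \<Gamma> = (v x - q \<Gamma>) * coefficient \<Gamma> x"
          "seq_val v \<Delta> = (v x - q \<Delta>) * coefficient \<Delta> x"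
          using val[of \<Gamma> "v x"] val[of \<Delta> "v x"] that by (auto simp: P_def N_def)
        ultimately have "(v x - q \<Gamma>) * (of_nat (a \<Gamma> \<Delta>) * coefficient \<Gamma> x)
            + (v x - q \<Delta>) * (of_nat (b \<Gamma> \<Delta>) * coefficient \<Delta> x) < 0"
          by (simp add: algebra_simps)
        moreover have "of_nat (b \<Gamma> \<Delta>) * coefficient \<Delta> x = - (of_nat (a \<Gamma> \<Delta>) * coefficient \<Gamma> x)"
          using ab by linarith
        ultimately have "(q \<Delta> - q \<Gamma>) * (of_nat (a \<Gamma> \<Delta>) * coefficient \<Gamma> x) < 0"
          by (simp add: algebra_simps)
        moreover have "0 < of_nat (a \<Gamma> \<Delta>) * coefficient \<Gamma> x"
          using ab that by (simp add: P_def)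
        ultimately have "q \<Delta> - q \<Gamma> < 0" by (metis less_asym mult_less_0_iff)
        then show ?thesis by simp
      qed
      then have "\<exists>t. (\<forall>a\<in>q ` N. a < t) \<and> (\<forall>b\<in>q ` P. t < b)"
        using fin by (intro finite_separation) auto
      then obtain t where t: "\<And>\<Gamma>. \<Gamma> \<in> P \<Longrightarrow> t < q \<Gamma>" "\<And>\<Delta>. \<Delta> \<in> N \<Longrightarrow> q \<Delta> < t"
        by auto
      have "seq_val (v(x := t)) \<Gamma> < 0" if \<Gamma>: "\<Gamma> \<in> F" for \<Gamma>
      proof -
        consider "\<Gamma> \<in> P" | "\<Gamma> \<in> N" | "\<Gamma> \<in> Z"
          using \<Gamma> by (force simp: P_def N_def Z_def)
        then show ?thesis
        proof cases
          case 1
          then show ?thesis using t(1) val[OF \<Gamma>] by (simp add: P_def mult_less_0_iff)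
        next
          case 2
          then show ?thesis using t(2) val[OF \<Gamma>] by (simp add: N_def mult_less_0_iff)
        next
          case 3
          \<comment> \<open>Writing \<open>v\<close> as \<open>v(x := v x)\<close> lets
            \<open>seq_val_upd\<close> apply to both sides, where the slope is 0.\<close>
          then have "seq_val (v(x := t)) \<Gamma> = seq_val (v(x := v x)) \<Gamma>"
            unfolding Z_def using seq_val_upd[OF rat[OF \<Gamma>], of v x t] seq_val_upd[OF rat[OF \<Gamma>], of v x "v x"]
            by simp
          then show ?thesis using 3 neg by (simp add: F'_def)
        qed
      qed
      then show False using insert.prems(4)[of "v(x := t)"] by (meson not_le)
    qed
  qed
  then show ?case using sums_of_idem[OF F'_sub] by blast
qed

subsection \<open>Derivations without \<open>T\<close>\<close>

abbreviation (input) HR0 :: "'v hypersequent \<Rightarrow> bool" where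
  "HR0 \<equiv> HR (- {R_CAN, R_T})"

lemma HR0_weaken:
  assumes "HR0 G" "\<And>\<Gamma>. \<Gamma> \<in># H \<Longrightarrow> wf_sequent \<Gamma>"
  shows "HR0 (G + H)"
  using assms(2)
proof (induction H)
  case empty
  then show ?case using assms(1) by simp
next
  case (add \<Gamma> H)
  then show ?case using HR.W[of "- {R_CAN, R_T}" \<Gamma> "G + H"] by simp
qed

lemma HR0_contract:
  assumes "HR0 (G + H)" "set_mset H \<subseteq> set_mset G"
  shows "HR0 G"
  using assms
proof (induction H)
  case (add \<Gamma> H)
  then obtain G' where "G = add_mset \<Gamma> G'" by (auto dest: multi_member_split)
  then show ?case
    using add HR.C[of "- {R_CAN, R_T}" "G' + H" \<Gamma>] by simp
qed simp

text \<open>Iterated \<open>S\<close> detaches one member at a time. With \<open>M\<close> empty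
  there would be a leftover sequent \<open>{#}\<close> to delete, hence the assumption.\<close>

lemma HR0_split:
  assumes "M \<noteq> {#}" "HR0 (G + {#\<Sum>\<^sub># M#})"
  shows "HR0 (G + M)"
  using assms
proof (induction M arbitrary: G)
  case (add \<Gamma> M)
  show ?case
  proof (cases "M = {#}")
    case True
    then show ?thesis using add.prems by simp
  next
    case False
    have "HR0 (G + {#\<Gamma>, \<Sum>\<^sub># M#})"
      using add.prems by (intro HR.S) simp_all
    then show ?thesis using add.IH[OF False, of "G + {#\<Gamma>#}"] by (simp add: add_mset_commute)
  qed
qed simp

text \<open>Read backwards, \<open>ID\<close> removes all occurrences of a variable at once; a
  vanishing coefficient is precisely its side condition on the two sums. The induction ends at
  \<open>INIT\<close>.\<close>

lemma HR0_vanishing: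
  assumes "wf_sequent \<Gamma>" "rational_literals \<Gamma>" "\<And>x. coefficient \<Gamma> x = 0"
  shows "HR0 {#\<Gamma>#}"
  using assms
proof (induction "size \<Gamma>" arbitrary: \<Gamma> rule: less_induct)
  case less
  show ?case
  proof (cases "\<Gamma> = {#}")
    case True
    then show ?thesis by (simp add: HR.INIT)
  next
    case False
    then obtain r A where rA: "(r, A) \<in># \<Gamma>" by (auto simp: multiset_eq_iff)
    then have "literal A" using less.prems(2) by (auto simp: rational_literals_def)
    then obtain x where x: "A = Var x \<or> A = NVar x" by (cases A) auto
    \<comment> \<open>\<open>ID\<close> takes vectors of weights, so the entries with a given
      literal are listed in some order.\<close>
    have ex: "\<exists>rs. filter_mset (\<lambda>p. snd p = B) \<Gamma> = rs \<odot> B \<and> pos rs" for B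
    proof -
      obtain ps where ps: "mset ps = filter_mset (\<lambda>p. snd p = B) \<Gamma>" using ex_mset by blast
      have mem: "snd p = B \<and> 0 < fst p" if "p \<in> set ps" for p
      proof -
        have "p \<in># filter_mset (\<lambda>p. snd p = B) \<Gamma>" using that by (simp flip: ps)
        then show ?thesis using less.prems(1) by (auto simp: wf_sequent_def)
      qed
      have "map (\<lambda>r. (r, B)) (map fst ps) = ps"
        unfolding map_map using mem by (intro map_idI) force
      then have "filter_mset (\<lambda>p. snd p = B) \<Gamma> = map fst ps \<odot> B"
        using ps by (simp only: weigh_def)
      moreover have "pos (map fst ps)" using mem by (auto simp: pos_def)
      ultimately show ?thesis by blast
    qed
    obtain rs where rs: "filter_mset (\<lambda>p. snd p = Var x) \<Gamma> = rs \<odot> Var x" "pos rs"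
      using ex by blast
    obtain ss where ss: "filter_mset (\<lambda>p. snd p = NVar x) \<Gamma> = ss \<odot> NVar x" "pos ss"
      using ex by blast
    define \<Delta> where "\<Delta> = filter_mset (\<lambda>p. snd p \<noteq> Var x \<and> snd p \<noteq> NVar x) \<Gamma>"
    have \<Gamma>: "\<Gamma> = \<Delta> + rs \<odot> Var x + ss \<odot> NVar x"
      unfolding \<Delta>_def rs(1)[symmetric] ss(1)[symmetric]
      by (rule multiset_eqI) (simp del: split_paired_All)
    have "(r, A) \<notin># \<Delta>" using x by (auto simp: \<Delta>_def)
    then have "\<Delta> \<noteq> \<Gamma>" using rA by auto
    moreover have "\<Delta> \<subseteq># \<Gamma>" by (simp add: \<Delta>_def)
    ultimately have smaller: "size \<Delta> < size \<Gamma>"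
      by (simp add: mset_subset_size subset_mset.less_le)
    have \<Delta>x: "coefficient \<Delta> x = 0"
      unfolding \<Delta>_def by (induction \<Gamma>) auto
    then have sums: "sum_list rs = sum_list ss"
      using less.prems(3)[of x] by (simp add: \<Gamma>)
    have "HR0 {#\<Delta>#}"
    proof (rule less.hyps[OF smaller])
      show "wf_sequent \<Delta>" "rational_literals \<Delta>" using less.prems(1,2) by (auto simp: \<Gamma>)
      show "coefficient \<Delta> y = 0" for y
        using less.prems(3)[of y] \<Delta>x by (cases "y = x") (auto simp: \<Gamma>)
    qed
    then show ?thesis
      using HR.ID[of "- {R_CAN, R_T}" rs ss "{#}" \<Delta> x] rs ss sums by (simp add: \<Gamma>)
  qed
qed

lemma HR0_literals:
  assumes "wf_hypersequent G" "\<And>\<Gamma>. \<Gamma> \<in># G \<Longrightarrow> rational_literals \<Gamma>" "valid G"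
  shows "HR0 G"
proof -
  define X where "X = (\<Union>\<Gamma>\<in>set_mset G. {x. coefficient \<Gamma> x \<noteq> 0})"
  have "\<exists>\<Gamma>\<in>sums_of (set_mset G). \<forall>x. coefficient \<Gamma> x = 0"
  proof (rule valid_imp_vanishing_sum)
    show "finite X" by (simp add: X_def finite_coefficient_support)
  qed (use assms in \<open>auto simp: X_def valid_def\<close>)
  then obtain M where M: "M \<noteq> {#}" "set_mset M \<subseteq> set_mset G"
    and zero: "\<And>x. coefficient (\<Sum>\<^sub># M) x = 0"
    by (auto simp: sums_of_def)
  have "wf_sequent (\<Sum>\<^sub># M)" "rational_literals (\<Sum>\<^sub># M)"
    using M(2) assms(1,2) by (fastforce simp: wf_sequent_def rational_literals_def wf_hypersequent_def)+
  then have "HR0 {#\<Sum>\<^sub># M#}" using zero by (rule HR0_vanishing)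
  then have "HR0 M" using HR0_split[OF M(1), of "{#}"] by simp
  \<comment> \<open>\<open>M\<close> may repeat some members of \<open>G\<close> and omit others:
    all of \<open>G\<close> is added first, then every member of \<open>M\<close> is contracted into
    its copy in \<open>G\<close>.\<close>
  then have "HR0 (M + G)" using assms(1) by (intro HR0_weaken) (auto simp: wf_hypersequent_def)
  then show ?thesis using HR0_contract[of G M] M(2) by (simp add: add.commute)
qed

subsection \<open>Reduction to literals\<close>

text \<open>\<open>Zero\<close> has positive complexity because deleting it must lower the induction
  measure.\<close>

primrec complexity :: "'v rterm \<Rightarrow> nat" where
  "complexity (Var x) = 0"
| "complexity (NVar x) = 0"
| "complexity Zero = 1"
| "complexity (Add A B) = Suc (complexity A + complexity B)"
| "complexity (Scale r A) = Suc (complexity A)"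
| "complexity (Join A B) = Suc (complexity A + complexity B)"
| "complexity (Meet A B) = Suc (complexity A + complexity B)"

text \<open>
  Base 3 because \<open>\<squnion>\<close>, read backwards, replaces one sequent by two of smaller complexity.
\<close>
definition hyper_weight :: "'v hypersequent \<Rightarrow> nat" where
  "hyper_weight G = (\<Sum>\<Gamma>\<in>#G. 3 ^ (\<Sum>(r, A)\<in>#\<Gamma>. complexity A))"

lemma hyper_weight_step:
  assumes "complexity B < complexity A"
  shows "hyper_weight (G + {#\<Gamma> + {#(s, B)#}#}) < hyper_weight (G + {#\<Gamma> + {#(r, A)#}#})"
  using assms by (simp add: hyper_weight_def)

lemma hyper_weight_plus:
  "hyper_weight (G + {#\<Gamma> + {#(r, A)#} + {#(r, B)#}#}) < hyper_weight (G + {#\<Gamma> + {#(r, Add A B)#}#})"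
  by (simp add: hyper_weight_def add_ac)

text \<open>Both new exponents are at most \<open>m\<close> and the old one is \<open>Suc m\<close>,
  so the claim follows from \<open>2 * 3 ^ m < 3 * 3 ^ m\<close>.\<close>

lemma hyper_weight_join:
  "hyper_weight (G + {#\<Gamma> + {#(r, A)#}, \<Gamma> + {#(r, B)#}#})
    < hyper_weight (G + {#\<Gamma> + {#(r, Join A B)#}#})"
proof -
  define k where "k = (\<Sum>(r, A)\<in>#\<Gamma>. complexity A)"
  define m where "m = complexity A + complexity B + k"
  have "(3::nat) ^ (complexity A + k) \<le> 3 ^ m" "(3::nat) ^ (complexity B + k) \<le> 3 ^ m"
    by (auto simp: m_def intro: power_increasing)
  moreover have "(0::nat) < 3 ^ m" by simp
  ultimately have "(3::nat) ^ (complexity A + k) + 3 ^ (complexity B + k) < 3 ^ Suc m"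
    unfolding power_Suc by linarith
  then show ?thesis by (simp add: hyper_weight_def k_def m_def add_ac)
qed

lemma weigh_single: "[r] \<odot> A = {#(r, A)#}"
  by (simp add: weigh_def)

text \<open>Non-literal entries are decomposed one at a time. Premises inherit validity because the
  logical rules are invertible, and rationality because weights are only kept or multiplied by a
  scalar of the term.\<close>

lemma valid_rational_imp_HR0:
  assumes "wf_hypersequent G" "rational_hypersequent G" "valid G"
  shows "HR0 G"
  using assms
proof (induction "hyper_weight G" arbitrary: G rule: less_induct)
  case less
  show ?case
  proof (cases "\<forall>\<Gamma>\<in>#G. rational_literals \<Gamma>")
    case True
    then show ?thesis using less.prems by (intro HR0_literals) auto
  next
    case False
    then obtain \<Gamma>' where \<Gamma>': "\<Gamma>' \<in># G" "\<not> rational_literals \<Gamma>'" by blast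
    then obtain r A where rA: "(r, A) \<in># \<Gamma>'" "\<not> literal A"
      using less.prems(2) by (fastforce simp: rational_literals_def rational_hypersequent_def)
    obtain \<Gamma> where "\<Gamma>' = \<Gamma> + {#(r, A)#}" using rA(1) by (auto dest: multi_member_split)
    moreover obtain H where "G = H + {#\<Gamma>'#}" using \<Gamma>'(1) by (auto dest: multi_member_split)
    ultimately have G: "G = H + {#\<Gamma> + {#(r, A)#}#}" by simp
    \<comment> \<open>Logical rules are applied to one-element vectors only; longer vectors occur
      just in \<open>ID\<close>.\<close>
    have r: "0 < r" "pos [r]"
      using less.prems(1) by (auto simp: G wf_hypersequent_def wf_sequent_def pos_def)
    note defs = wf_hypersequent_def wf_sequent_def rational_hypersequent_def
    note IH = less.hyps and wf = less.prems(1)[unfolded G] and rat = less.prems(2)[unfolded G]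
      and val = less.prems(3)[unfolded G]
    show ?thesis
    proof (cases A)
      case Zero
      have "hyper_weight (H + {#\<Gamma>#}) < hyper_weight G" by (simp add: G Zero hyper_weight_def)
      then have "HR0 (H + {#\<Gamma>#})"
        by (rule IH) (use wf rat val in \<open>auto simp: defs valid_add_mset Zero\<close>)
      then show ?thesis
        using HR.zero[of "- {R_CAN, R_T}" "[r]" H \<Gamma>] r by (simp add: G Zero weigh_single)
    next
      case (Add B C)
      have "HR0 (H + {#\<Gamma> + {#(r, B)#} + {#(r, C)#}#})"
        by (rule IH, unfold G Add, rule hyper_weight_plus)
          (use wf rat val in \<open>auto simp: defs valid_add_mset Add algebra_simps\<close>)
      then show ?thesis
        using HR.plus[of "- {R_CAN, R_T}" "[r]" H \<Gamma> B C] r by (simp add: G Add weigh_single)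
    next
      case (Scale s B)
      have s: "0 < s" using wf by (auto simp: defs Scale)
      have "HR0 (H + {#\<Gamma> + {#(s * r, B)#}#})"
        by (rule IH, unfold G Scale, rule hyper_weight_step)
          (use wf rat val s r in \<open>auto simp: defs valid_add_mset Scale algebra_simps\<close>)
      then show ?thesis
        using HR.times[of "- {R_CAN, R_T}" "[r]" s H \<Gamma> B] r s by (simp add: G Scale weigh_single)
    next
      case (Join B C)
      \<comment> \<open>At each valuation the maximum is attained by \<open>B\<close> or
        \<open>C\<close>, so one of the two sequents keeps the old value.\<close>
      have "valid (H + {#\<Gamma> + {#(r, B)#}, \<Gamma> + {#(r, C)#}#})"
        unfolding valid_def
      proof
        fix v
        show "\<exists>\<Delta>\<in>#H + {#\<Gamma> + {#(r, B)#}, \<Gamma> + {#(r, C)#}#}. 0 \<le> seq_val v \<Delta>"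
          using val[unfolded valid_plus_single, rule_format, of v]
          by (auto simp: Join max_def split: if_splits)
      qed
      then have "HR0 (H + {#\<Gamma> + {#(r, B)#}, \<Gamma> + {#(r, C)#}#})"
        by (intro IH, unfold G Join, intro hyper_weight_join)
          (use wf rat in \<open>auto simp: defs Join\<close>)
      then show ?thesis
        using HR.join[of "- {R_CAN, R_T}" "[r]" H \<Gamma> B C] r by (simp add: G Join weigh_single)
    next
      case (Meet B C)
      \<comment> \<open>Replacing a meet by either component can only raise the value of the
        sequent, so both premises stay valid.\<close>
      have le: "r * min (term_val v B) (term_val v C) \<le> r * term_val v B"
        "r * min (term_val v B) (term_val v C) \<le> r * term_val v C" for v
        using r(1) by (auto intro: mult_left_mono)
      have "valid (H + {#\<Gamma> + {#(r, D)#}#})" if "D = B \<or> D = C" for D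
        unfolding valid_plus_single
      proof
        fix v
        show "(\<exists>\<Delta>\<in>#H. 0 \<le> seq_val v \<Delta>) \<or> 0 \<le> seq_val v (\<Gamma> + {#(r, D)#})"
          using val[unfolded valid_plus_single, rule_format, of v] le[of v] that
          by (auto simp: Meet)
      qed
      then have "HR0 (H + {#\<Gamma> + {#(r, D)#}#})" if "D = B \<or> D = C" for D
        using that
        by (intro IH, unfold G Meet, intro hyper_weight_step)
          (use wf rat in \<open>auto simp: defs Meet\<close>)
      then show ?thesis
        using HR.meet[of "- {R_CAN, R_T}" "[r]" H \<Gamma> B C] r by (simp add: G Meet weigh_single)
    qed (use rA(2) in auto)
  qed
qed

theorem theorem3p15:
  fixes G :: "'v::countable hypersequent"
  assumes "wf_hypersequent G"
    and "rational_hypersequent G"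
    and "HR (- {R_CAN}) G"
  shows "HR (- {R_CAN, R_T}) G"
  using assms(1,2) HR_imp_valid[OF assms(3)] by (rule valid_rational_imp_HR0)

end
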